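(* Let $n\ge1$, let $\mathcal{E}$ be a Hilbert space, and let $L_1,L_2\in\mathcal{B}(\mathcal{E},\mathcal{F}_n^2\otimes\mathcal{E})$ be symbols with odometer maps $W_{L_1},W_{L_2}\in\mathcal{B}(\mathcal{F}_n^2\otimes\mathcal{E})$. Then $\mathrm{ran}\,L_1\subseteq\mathrm{ran}\,L_2$ if and only if there exists a bounded operator $\Gamma\in\mathcal{B}(\mathcal{F}_n^2\otimes\mathcal{E})$ satisfying $$\Gamma(\Omega\otimes\mathcal{E})\subseteq\Omega\otimes\mathcal{E}\quad\text{and}\quad W_{L_1}=W_{L_2}\Gamma.$$ Further, if $W_{L_2}$ is an isometry, then, for every $\Gamma\in\mathcal{B}(\mathcal{F}_n^2\otimes\mathcal{E})$ satisfying $\Gamma(\Omega\otimes\mathcal{E})\subseteq\Omega\otimes\mathcal{E}$ and $W_{L_1}=W_{L_2}\Gamma$, $W_{L_1}$ is an isometry if and only if $\Gamma$ is an isometry.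
   Context: Hilbert spaces are separable and complex; $\mathcal{B}(\mathcal{H},\mathcal{K})$ denotes bounded linear operators. $F_n^+$ is the free monoid of words $\mu=\mu_1\cdots\mu_m$ in the letters $1,\dots,n$, with empty word $\emptyset$. The full Fock space $\mathcal{F}_n^2=\mathbb{C}\Omega\oplus\bigoplus_{k\ge1}(\mathbb{C}^n)^{\otimes k}$ has orthonormal basis $e_\mu=e_{\mu_1}\otimes\cdots\otimes e_{\mu_m}$, $\mu\in F_n^+$, with $e_\emptyset=\Omega$ (vacuum vector); $e_k^m:=e_k^{\otimes m}$, $e_k^0=\Omega$, and $\Omega$ acts as a unit for left tensoring. For $f\in\mathcal{F}_n^2\otimes\mathcal{E}$, $e_1^p\otimes f$ means left tensoring by $e_1^p$. Odometer map: for $L\in\mathcal{B}(\mathcal{E},\mathcal{F}_n^2\otimes\mathcal{E})$, $W_L$ is the operator on $\mathcal{F}_n^2\otimes\mathcal{E}$ given by $W_L(\Omega\otimes\eta)=L\eta$; $W_L(e_n^m\otimes\eta)=e_1^m\otimes L\eta$ for $m\ge1$; and, for a nonempty word $\mu=\mu_1\cdots\mu_m$ having some letter $\ne n$, with $k$ the smallest index such that $\mu_k\neq n$, $W_L(e_\mu\otimes\eta)=e_1^{k-1}\otimes e_{\mu_k+1}\otimes e_{\mu_{k+1}}\otimes\cdots\otimes e_{\mu_m}\otimes\eta$. It is a standing assumption that the odometer maps considered are bounded operators on $\mathcal{F}_n^2\otimes\mathcal{E}$. *)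

theory Defs
  imports "HOL-Analysis.Analysis"
begin

section \<open>Complex Hilbert spaces\<close>

text \<open>
  The inner product is linear in the first argument. Its real part is required to be the
  inner product of the underlying real space, so that norm, metric and topology are the
  ones of \<^class>\<open>real_inner\<close>; in particular the norm is induced by \<open>cinner\<close>
  (lemma \<open>norm_eq_sqrt_cinner\<close>).
\<close>

class complex_inner = real_inner +
  fixes scaleC :: "complex \<Rightarrow> 'a \<Rightarrow> 'a"  (infixr "*\<^sub>C" 75)
    and cinner :: "'a \<Rightarrow> 'a \<Rightarrow> complex"
  assumes scaleC_of_real: "complex_of_real r *\<^sub>C x = scaleR r x"
    and scaleC_add_right: "a *\<^sub>C (x + y) = a *\<^sub>C x + a *\<^sub>C y"
    and scaleC_add_left: "(a + b) *\<^sub>C x = a *\<^sub>C x + b *\<^sub>C x"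
    and scaleC_scaleC: "a *\<^sub>C b *\<^sub>C x = (a * b) *\<^sub>C x"
    and cinner_commute: "cinner x y = cnj (cinner y x)"
    and cinner_add_left: "cinner (x + y) z = cinner x z + cinner y z"
    and cinner_scaleC_left: "cinner (a *\<^sub>C x) y = a * cinner x y"
    and Re_cinner: "Re (cinner x y) = inner x y"

class chilbert_space = complex_inner + complete_space

lemma scaleC_one [simp]: "1 *\<^sub>C (x::'a::complex_inner) = x"
  using scaleC_of_real[of 1 x] by simp

lemma scaleC_zero_left [simp]: "0 *\<^sub>C (x::'a::complex_inner) = 0"
  using scaleC_of_real[of 0 x] by simp

lemma scaleC_zero_right [simp]: "a *\<^sub>C (0::'a::complex_inner) = 0"
  using scaleC_add_right[of a "0::'a" 0] by simp

lemma cinner_zero_left [simp]: "cinner (0::'a::complex_inner) x = 0"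
  using cinner_scaleC_left[of 0 x x] by simp

lemma cinner_zero_right [simp]: "cinner x (0::'a::complex_inner) = 0"
  using cinner_commute[of x 0] by simp

lemma cinner_scaleC_right: "cinner x (a *\<^sub>C y) = cnj a * cinner x (y::'a::complex_inner)"
  by (metis cinner_commute cinner_scaleC_left complex_cnj_mult)

lemma cinner_self: "cinner x x = complex_of_real ((norm (x::'a::complex_inner))\<^sup>2)"
proof -
  have "Im (cinner x x) = 0"
    using cinner_commute[of x x] by (metis cnj.sel(2) equal_neg_zero)
  then show ?thesis
    by (simp add: complex_eq_iff Re_cinner dot_square_norm)
qed

lemma norm_eq_sqrt_cinner: "norm x = sqrt (Re (cinner x (x::'a::complex_inner)))"
  by (simp add: Re_cinner norm_eq_sqrt_inner)

lemma norm_scaleC [simp]: "norm (a *\<^sub>C x) = cmod a * norm (x::'a::complex_inner)"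
proof -
  have "complex_of_real ((norm (a *\<^sub>C x))\<^sup>2) = (a * cnj a) * cinner x x"
    by (simp only: cinner_self[symmetric] cinner_scaleC_left cinner_scaleC_right mult_ac)
  also have "\<dots> = complex_of_real ((cmod a * norm x)\<^sup>2)"
    by (simp only: complex_norm_square[symmetric] cinner_self of_real_mult[symmetric]
        power_mult_distrib of_real_power[symmetric])
  finally have "(norm (a *\<^sub>C x))\<^sup>2 = (cmod a * norm x)\<^sup>2"
    using of_real_eq_iff by blast
  then show ?thesis by (simp add: power2_eq_iff_nonneg)
qed

lemma norm_cinner_le: "cmod (cinner x y) \<le> 2 * (norm x * norm (y::'a::complex_inner))"
proof -
  have "\<bar>Re (cinner x y)\<bar> \<le> norm x * norm y"
    by (simp add: Re_cinner Cauchy_Schwarz_ineq2)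
  moreover have "\<bar>Im (cinner x y)\<bar> \<le> norm x * norm y"
  proof -
    have "Im (cinner x y) = Re (cinner (- \<i> *\<^sub>C x) y)"
      by (simp only: cinner_scaleC_left) simp
    also have "\<bar>\<dots>\<bar> \<le> norm (- \<i> *\<^sub>C x) * norm y"
      unfolding Re_cinner by (rule Cauchy_Schwarz_ineq2)
    finally show ?thesis by simp
  qed
  ultimately show ?thesis using cmod_le[of "cinner x y"] by linarith
qed

instantiation complex :: chilbert_space
begin

definition scaleC_complex :: "complex \<Rightarrow> complex \<Rightarrow> complex"
  where "scaleC_complex a x = a * x"

definition cinner_complex :: "complex \<Rightarrow> complex \<Rightarrow> complex"
  where "cinner_complex x y = x * cnj y"

instance
  by standard
    (auto simp: scaleC_complex_def cinner_complex_def scaleR_conv_of_real algebra_simps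
      inner_complex_def)

end


section \<open>Square-summable families\<close>

text \<open>
  For a complex Hilbert space \<open>E\<close>, \<open>('i, E) ell2\<close> is the Hilbert space
  \<open>\<ell>\<^sup>2(I; E)\<close>, which is the Hilbert space tensor product of \<open>\<ell>\<^sup>2(I)\<close> and \<open>E\<close>: the elementary
  tensors (\<open>tensor\<close> below) satisfy lemma \<open>cinner_tensor\<close> and are total by lemma
  \<open>ell2_finite_approximation\<close>.
\<close>

typedef (overloaded) ('i, 'e::real_inner) ell2 =
  "{f :: 'i \<Rightarrow> 'e. (\<lambda>i. (norm (f i))\<^sup>2) summable_on UNIV}"
  morphisms coord Abs_ell2
  by (rule exI[of _ "\<lambda>_. 0"]) simp

lemma coord_summable: "(\<lambda>i. (norm (coord f i))\<^sup>2) summable_on UNIV"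
  using coord[of f] by simp

lemma coord_Abs:
  assumes "(\<lambda>i. (norm (f i))\<^sup>2) summable_on UNIV"
  shows "coord (Abs_ell2 f) = f"
  using assms by (simp add: Abs_ell2_inverse)

lemma ell2_eqI: "(\<And>i. coord f i = coord g i) \<Longrightarrow> f = g"
  by (simp add: coord_inject[symmetric] ext)

lemma square_norm_add_le: "(norm (x + y))\<^sup>2 \<le> 2 * (norm x)\<^sup>2 + 2 * (norm (y::'a::real_inner))\<^sup>2"
proof -
  have "(norm (x + y))\<^sup>2 \<le> (norm x + norm y)\<^sup>2"
    by (simp add: norm_triangle_ineq power_mono)
  also have "\<dots> \<le> 2 * (norm x)\<^sup>2 + 2 * (norm y)\<^sup>2"
    using sum_squares_bound[of "norm x" "norm y"] by (simp add: power2_sum)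
  finally show ?thesis .
qed

lemma summable_square_add:
  fixes f g :: "'i \<Rightarrow> 'e::real_inner"
  assumes "(\<lambda>i. (norm (f i))\<^sup>2) summable_on UNIV" "(\<lambda>i. (norm (g i))\<^sup>2) summable_on UNIV"
  shows "(\<lambda>i. (norm (f i + g i))\<^sup>2) summable_on UNIV"
proof (rule summable_on_comparison_test)
  show "(\<lambda>i. 2 * (norm (f i))\<^sup>2 + 2 * (norm (g i))\<^sup>2) summable_on UNIV"
    by (intro summable_on_add summable_on_cmult_right assms)
qed (auto intro: square_norm_add_le)

lemma inner_summable:
  "(\<lambda>i. inner (coord f i) (coord g i)) summable_on UNIV"
proof (rule Infinite_Sum.abs_summable_summable[OF Infinite_Sum.abs_summable_on_comparison_test'])
  show "(\<lambda>i. (norm (coord f i))\<^sup>2 + (norm (coord g i))\<^sup>2) summable_on UNIV"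
    by (intro summable_on_add coord_summable)
  fix i
  have "norm (inner (coord f i) (coord g i)) \<le> norm (coord f i) * norm (coord g i)"
    by (simp add: Cauchy_Schwarz_ineq2)
  also have "\<dots> \<le> (norm (coord f i))\<^sup>2 + (norm (coord g i))\<^sup>2"
    using sum_squares_bound[of "norm (coord f i)" "norm (coord g i)"]
      mult_nonneg_nonneg[OF norm_ge_zero[of "coord f i"] norm_ge_zero[of "coord g i"]] by linarith
  finally show "norm (inner (coord f i) (coord g i)) \<le> (norm (coord f i))\<^sup>2 + (norm (coord g i))\<^sup>2" .
qed

lemma cinner_summable:
  fixes f g :: "('i, 'e::complex_inner) ell2"
  shows "(\<lambda>i. cinner (coord f i) (coord g i)) summable_on UNIV"
proof (rule Infinite_Sum.abs_summable_summable[OF Infinite_Sum.abs_summable_on_comparison_test'])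
  show "(\<lambda>i. (norm (coord f i))\<^sup>2 + (norm (coord g i))\<^sup>2) summable_on UNIV"
    by (intro summable_on_add coord_summable)
  fix i
  show "norm (cinner (coord f i) (coord g i)) \<le> (norm (coord f i))\<^sup>2 + (norm (coord g i))\<^sup>2"
    using norm_cinner_le[of "coord f i" "coord g i"]
      sum_squares_bound[of "norm (coord f i)" "norm (coord g i)"] by linarith
qed

instantiation ell2 :: (type, real_inner) real_inner
begin

definition zero_ell2 :: "('a, 'b) ell2" where "0 = Abs_ell2 (\<lambda>_. 0)"
definition plus_ell2 :: "('a, 'b) ell2 \<Rightarrow> ('a, 'b) ell2 \<Rightarrow> ('a, 'b) ell2"
  where "f + g = Abs_ell2 (\<lambda>i. coord f i + coord g i)"
definition scaleR_ell2 :: "real \<Rightarrow> ('a, 'b) ell2 \<Rightarrow> ('a, 'b) ell2"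
  where "r *\<^sub>R f = Abs_ell2 (\<lambda>i. r *\<^sub>R coord f i)"
definition uminus_ell2 :: "('a, 'b) ell2 \<Rightarrow> ('a, 'b) ell2"
  where "- f = Abs_ell2 (\<lambda>i. - coord f i)"
definition minus_ell2 :: "('a, 'b) ell2 \<Rightarrow> ('a, 'b) ell2 \<Rightarrow> ('a, 'b) ell2"
  where "f - g = Abs_ell2 (\<lambda>i. coord f i - coord g i)"
definition inner_ell2 :: "('a, 'b) ell2 \<Rightarrow> ('a, 'b) ell2 \<Rightarrow> real"
  where "inner f g = (\<Sum>\<^sub>\<infinity>i. inner (coord f i) (coord g i))"
definition norm_ell2 :: "('a, 'b) ell2 \<Rightarrow> real"
  where "norm f = sqrt (\<Sum>\<^sub>\<infinity>i. (norm (coord f i))\<^sup>2)"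
definition sgn_ell2 where "sgn (f::('a, 'b) ell2) = inverse (norm f) *\<^sub>R f"
definition dist_ell2 where "dist (f::('a, 'b) ell2) g = norm (f - g)"
definition uniformity_ell2
  where "(uniformity :: (('a, 'b) ell2 \<times> ('a, 'b) ell2) filter) = (INF e\<in>{0 <..}. principal {(x::('a, 'b) ell2, y). dist x y < e})"
definition open_ell2
  where "open (U::('a, 'b) ell2 set) = (\<forall>x\<in>U. \<forall>\<^sub>F (x', y) in uniformity. x' = x \<longrightarrow> y \<in> U)"

lemma coord_zero_aux: "coord (0::('a, 'b) ell2) i = 0"
  by (simp add: zero_ell2_def coord_Abs)
lemma coord_add_aux: "coord (f + g) i = coord f i + coord (g::('a, 'b) ell2) i"
  by (simp add: plus_ell2_def coord_Abs summable_square_add coord_summable)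
lemma coord_scaleR_aux: "coord (r *\<^sub>R f) i = r *\<^sub>R coord (f::('a, 'b) ell2) i"
  by (simp add: scaleR_ell2_def coord_Abs power_mult_distrib summable_on_cmult_right coord_summable)
lemma coord_uminus_aux: "coord (- f) i = - coord (f::('a, 'b) ell2) i"
  by (simp add: uminus_ell2_def coord_Abs coord_summable)
lemma coord_diff_aux: "coord (f - g) i = coord f i - coord (g::('a, 'b) ell2) i"
  using summable_square_add[OF coord_summable[of f] coord_summable[of "- g"]]
  by (simp add: minus_ell2_def coord_Abs coord_uminus_aux)

instance
proof
  fix f g h :: "('a, 'b) ell2" and r s :: real
  note [simp] = coord_zero_aux coord_add_aux coord_scaleR_aux coord_uminus_aux coord_diff_aux
  show "f + g + h = f + (g + h)" by (rule ell2_eqI) (simp add: add.assoc)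
  show "f + g = g + f" by (rule ell2_eqI) (simp add: add.commute)
  show "0 + f = f" by (rule ell2_eqI) simp
  show "- f + f = 0" by (rule ell2_eqI) simp
  show "f - g = f + - g" by (rule ell2_eqI) simp
  show "r *\<^sub>R (f + g) = r *\<^sub>R f + r *\<^sub>R g" by (rule ell2_eqI) (simp add: scaleR_add_right)
  show "(r + s) *\<^sub>R f = r *\<^sub>R f + s *\<^sub>R f" by (rule ell2_eqI) (simp add: scaleR_add_left)
  show "r *\<^sub>R s *\<^sub>R f = (r * s) *\<^sub>R f" by (rule ell2_eqI) simp
  show "1 *\<^sub>R f = f" by (rule ell2_eqI) simp
  show "sgn f = inverse (norm f) *\<^sub>R f" by (rule sgn_ell2_def)
  show "dist f g = norm (f - g)" by (rule dist_ell2_def)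
  show "uniformity = (INF e\<in>{0 <..}. principal {(x::('a, 'b) ell2, y). dist x y < e})"
    by (rule uniformity_ell2_def)
  show "open U = (\<forall>x\<in>U. \<forall>\<^sub>F (x', y) in uniformity. x' = x \<longrightarrow> y \<in> U)" for U :: "('a, 'b) ell2 set"
    by (rule open_ell2_def)
  show "inner f g = inner g f"
    by (simp add: inner_ell2_def inner_commute)
  show "inner (f + g) h = inner f h + inner g h"
    by (simp add: inner_ell2_def inner_add_left infsum_add inner_summable)
  show "inner (r *\<^sub>R f) g = r * inner f g"
    by (simp add: inner_ell2_def infsum_cmult_right')
  show "0 \<le> inner f f"
    by (simp add: inner_ell2_def infsum_nonneg)
  show "norm f = sqrt (inner f f)"
    by (simp add: norm_ell2_def inner_ell2_def dot_square_norm)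
  show "(inner f f = 0) = (f = 0)"
  proof
    assume "inner f f = 0"
    then have "inner (coord f i) (coord f i) = 0" for i
      by (intro nonneg_infsum_le_0D[of "\<lambda>i. inner (coord f i) (coord f i)" UNIV])
        (auto simp: inner_ell2_def inner_summable)
    then show "f = 0" by (auto intro!: ell2_eqI)
  qed (simp add: inner_ell2_def)
qed

end

lemmas coord_zero [simp] = coord_zero_aux
lemmas coord_add [simp] = coord_add_aux
lemmas coord_scaleR [simp] = coord_scaleR_aux
lemmas coord_uminus [simp] = coord_uminus_aux
lemmas coord_diff [simp] = coord_diff_aux

lemma coord_sum [simp]: "coord (sum f A) i = (\<Sum>a\<in>A. coord (f a) i)"
  by (induction A rule: infinite_finite_induct) auto

lemma norm_ell2_square: "(norm f)\<^sup>2 = (\<Sum>\<^sub>\<infinity>i. (norm (coord f i))\<^sup>2)"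
  by (simp add: norm_ell2_def infsum_nonneg)

lemma sum_norm_coord_le: "finite F \<Longrightarrow> (\<Sum>i\<in>F. (norm (coord f i))\<^sup>2) \<le> (norm f)\<^sup>2"
  unfolding norm_ell2_square by (intro finite_sum_le_infsum coord_summable) auto

lemma norm_coord_le: "norm (coord f i) \<le> norm f"
  using sum_norm_coord_le[of "{i}" f] by (simp add: power2_le_iff_abs_le)

lemma summable_square_scaleC:
  fixes f :: "'i \<Rightarrow> 'e::complex_inner"
  assumes "(\<lambda>i. (norm (f i))\<^sup>2) summable_on UNIV"
  shows "(\<lambda>i. (norm (a *\<^sub>C f i))\<^sup>2) summable_on UNIV"
  using assms by (simp add: power_mult_distrib summable_on_cmult_right)

instantiation ell2 :: (type, complex_inner) complex_inner
begin

definition scaleC_ell2 :: "complex \<Rightarrow> ('a, 'b) ell2 \<Rightarrow> ('a, 'b) ell2"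
  where "a *\<^sub>C f = Abs_ell2 (\<lambda>i. a *\<^sub>C coord f i)"
definition cinner_ell2 :: "('a, 'b) ell2 \<Rightarrow> ('a, 'b) ell2 \<Rightarrow> complex"
  where "cinner f g = (\<Sum>\<^sub>\<infinity>i. cinner (coord f i) (coord g i))"

lemma coord_scaleC_aux: "coord (a *\<^sub>C f) i = a *\<^sub>C coord (f::('a, 'b) ell2) i"
  by (simp only: scaleC_ell2_def coord_Abs[OF summable_square_scaleC[OF coord_summable]])

instance
proof
  fix f g h :: "('a, 'b) ell2" and a b :: complex and r :: real
  note [simp] = coord_scaleC_aux
  show "complex_of_real r *\<^sub>C f = r *\<^sub>R f" "a *\<^sub>C (f + g) = a *\<^sub>C f + a *\<^sub>C g"
    "(a + b) *\<^sub>C f = a *\<^sub>C f + b *\<^sub>C f" "a *\<^sub>C b *\<^sub>C f = (a * b) *\<^sub>C f"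
    by (auto intro!: ell2_eqI simp: scaleC_of_real scaleC_add_right scaleC_add_left scaleC_scaleC)
  show "cinner f g = cnj (cinner g f)"
    unfolding cinner_ell2_def infsum_cnj[symmetric] by (subst cinner_commute) simp
  show "cinner (f + g) h = cinner f h + cinner g h"
    by (simp add: cinner_ell2_def cinner_add_left infsum_add cinner_summable)
  show "cinner (a *\<^sub>C f) g = a * cinner f g"
    by (simp add: cinner_ell2_def cinner_scaleC_left infsum_cmult_right')
  show "Re (cinner f g) = inner f g"
    by (simp add: cinner_ell2_def inner_ell2_def Re_cinner infsum_Re[symmetric] cinner_summable)
qed

end

lemmas coord_scaleC [simp] = coord_scaleC_aux

instance ell2 :: (type, chilbert_space) chilbert_space
proof
  fix X :: "nat \<Rightarrow> ('a, 'b) ell2"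
  assume X: "Cauchy X"
  have cauchy_coord: "Cauchy (\<lambda>n. coord (X n) i)" for i
  proof (rule metric_CauchyI)
    fix e :: real assume "0 < e"
    with X obtain N where N: "\<And>m n. m \<ge> N \<Longrightarrow> n \<ge> N \<Longrightarrow> dist (X m) (X n) < e"
      by (meson metric_CauchyD)
    have "dist (coord (X m) i) (coord (X n) i) \<le> dist (X m) (X n)" for m n
      using norm_coord_le[of "X m - X n" i] by (simp add: dist_norm)
    then show "\<exists>N. \<forall>m\<ge>N. \<forall>n\<ge>N. dist (coord (X m) i) (coord (X n) i) < e"
      using N by (meson le_less_trans)
  qed
  define g where "g i = lim (\<lambda>n. coord (X n) i)" for i
  have g: "(\<lambda>n. coord (X n) i) \<longlonglongrightarrow> g i" for i
    using cauchy_coord[of i] unfolding g_def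
    by (simp add: Cauchy_convergent convergent_LIMSEQ_iff[symmetric])
  have tail: "(\<Sum>i\<in>F. (norm (coord (X m) i - g i))\<^sup>2) \<le> e\<^sup>2"
    if N: "\<And>m n. m \<ge> N \<Longrightarrow> n \<ge> N \<Longrightarrow> dist (X m) (X n) < e" and F: "finite F" and m: "m \<ge> N"
    for F e N m
  proof (rule LIMSEQ_le_const2)
    show "(\<lambda>n. \<Sum>i\<in>F. (norm (coord (X m) i - coord (X n) i))\<^sup>2)
        \<longlonglongrightarrow> (\<Sum>i\<in>F. (norm (coord (X m) i - g i))\<^sup>2)"
      by (intro tendsto_intros g)
    have "(\<Sum>i\<in>F. (norm (coord (X m) i - coord (X n) i))\<^sup>2) \<le> e\<^sup>2" if "n \<ge> N" for n
    proof -
      have "(\<Sum>i\<in>F. (norm (coord (X m) i - coord (X n) i))\<^sup>2) \<le> (norm (X m - X n))\<^sup>2"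
        using sum_norm_coord_le[OF F, of "X m - X n"] by simp
      also have "\<dots> \<le> e\<^sup>2"
        using N[OF m that] by (intro power_mono) (auto simp: dist_norm)
      finally show ?thesis .
    qed
    then show "\<exists>N. \<forall>n\<ge>N. (\<Sum>i\<in>F. (norm (coord (X m) i - coord (X n) i))\<^sup>2) \<le> e\<^sup>2" by blast
  qed
  have sum_diff: "(\<lambda>i. (norm (coord (X m) i - g i))\<^sup>2) summable_on UNIV"
    if "\<And>m n. m \<ge> N \<Longrightarrow> n \<ge> N \<Longrightarrow> dist (X m) (X n) < e" "m \<ge> N" for e N m
    using tail[OF that(1) _ that(2)]
    by (intro nonneg_bdd_above_summable_on) (auto intro!: bdd_aboveI[of _ "e\<^sup>2"])
  obtain N1 where N1: "\<And>m n. m \<ge> N1 \<Longrightarrow> n \<ge> N1 \<Longrightarrow> dist (X m) (X n) < 1"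
    using X by (meson metric_CauchyD zero_less_one)
  have "(\<lambda>i. (norm (g i))\<^sup>2) summable_on UNIV"
  proof -
    have "(\<lambda>i. (norm (g i - coord (X N1) i))\<^sup>2) summable_on UNIV"
      using sum_diff[OF N1 order.refl] by (simp add: norm_minus_commute)
    from summable_square_add[OF this coord_summable[of "X N1"]] show ?thesis by simp
  qed
  then have coord_g: "coord (Abs_ell2 g) = g" by (rule coord_Abs)
  have "X \<longlonglongrightarrow> Abs_ell2 g"
  proof (rule metric_LIMSEQ_I)
    fix e :: real assume "0 < e"
    then obtain N where N: "\<And>m n. m \<ge> N \<Longrightarrow> n \<ge> N \<Longrightarrow> dist (X m) (X n) < e / 2"
      using X by (meson half_gt_zero metric_CauchyD)
    have "dist (X m) (Abs_ell2 g) < e" if m: "m \<ge> N" for m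
    proof -
      have "(norm (X m - Abs_ell2 g))\<^sup>2 \<le> (e / 2)\<^sup>2"
        unfolding norm_ell2_square coord_diff coord_g
        by (intro infsum_le_finite_sums sum_diff[OF N m] tail[OF N _ m])
      then have "norm (X m - Abs_ell2 g) \<le> e / 2"
        using \<open>0 < e\<close> by (simp add: power2_le_iff_abs_le)
      then show ?thesis using \<open>0 < e\<close> by (simp add: dist_norm)
    qed
    then show "\<exists>no. \<forall>n\<ge>no. dist (X n) (Abs_ell2 g) < e" by blast
  qed
  then show "convergent X" by (auto simp: convergent_def)
qed

definition tensor :: "('i, complex) ell2 \<Rightarrow> 'e::complex_inner \<Rightarrow> ('i, 'e) ell2"
  where "tensor f \<eta> = Abs_ell2 (\<lambda>i. coord f i *\<^sub>C \<eta>)"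

lemma coord_tensor [simp]: "coord (tensor f \<eta>) i = coord f i *\<^sub>C \<eta>"
proof -
  have "(\<lambda>i. (norm (coord f i *\<^sub>C \<eta>))\<^sup>2) summable_on UNIV"
    by (simp add: power_mult_distrib summable_on_cmult_left coord_summable)
  then show ?thesis by (simp add: tensor_def coord_Abs)
qed

lemma cinner_tensor: "cinner (tensor f \<eta>) (tensor g \<xi>) = cinner f g * cinner \<eta> \<xi>"
proof -
  have "cinner (tensor f \<eta>) (tensor g \<xi>)
      = (\<Sum>\<^sub>\<infinity>i. cinner (coord f i) (coord g i) * cinner \<eta> \<xi>)"
    by (simp add: cinner_ell2_def[of "tensor f \<eta>"] cinner_scaleC_left cinner_scaleC_right
        cinner_complex_def mult_ac)
  also have "\<dots> = cinner f g * cinner \<eta> \<xi>"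
    by (simp add: infsum_cmult_left' cinner_ell2_def)
  finally show ?thesis .
qed

definition ket :: "'i \<Rightarrow> ('i, complex) ell2"
  where "ket i = Abs_ell2 (\<lambda>j. if j = i then 1 else 0)"

lemma coord_ket [simp]: "coord (ket i) j = (if j = i then 1 else 0)"
proof -
  have "(\<lambda>j. (norm (if j = i then 1 else 0 :: complex))\<^sup>2) summable_on UNIV"
    by (rule finite_nonzero_values_imp_summable_on) simp
  then show ?thesis by (simp add: ket_def coord_Abs)
qed

lemma ell2_finite_approximation:
  fixes f :: "('i, 'e::complex_inner) ell2"
  assumes "e > 0"
  obtains F where "finite F" "norm (f - (\<Sum>i\<in>F. tensor (ket i) (coord f i))) < e"
proof -
  let ?h = "\<lambda>i. (norm (coord f i))\<^sup>2"
  have e2: "0 < (e / 2)\<^sup>2" using assms by simp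
  obtain F where F: "finite F" and F': "dist (sum ?h F) (infsum ?h UNIV) \<le> (e / 2)\<^sup>2"
    using infsum_finite_approximation[OF coord_summable[of f] \<open>0 < (e / 2)\<^sup>2\<close>] by blast
  let ?d = "f - (\<Sum>i\<in>F. tensor (ket i) (coord f i))"
  have c: "coord ?d i = (if i \<in> F then 0 else coord f i)" for i
  proof -
    have "(\<Sum>j\<in>F. (if i = j then 1 else 0 :: complex) *\<^sub>C coord f j)
        = (\<Sum>j\<in>F. if i = j then coord f j else 0)"
      by (rule sum.cong) auto
    then show ?thesis using F by simp
  qed
  have "(norm ?d)\<^sup>2 = infsum ?h (- F)"
    unfolding norm_ell2_square c by (rule infsum_cong_neutral) auto
  also have "\<dots> = infsum ?h UNIV - sum ?h F"
  proof -
    have "infsum ?h (F \<union> - F) = infsum ?h F + infsum ?h (- F)"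
      by (rule infsum_Un_disjoint)
        (use F summable_on_subset_banach[OF coord_summable[of f], of "- F"] in auto)
    then show ?thesis using F by (simp add: Compl_partition)
  qed
  also have "\<dots> \<le> (e / 2)\<^sup>2"
    using F' by (simp add: dist_real_def)
  finally have "norm ?d \<le> e / 2"
    using assms by (simp add: power2_le_iff_abs_le)
  with assms have "norm ?d < e" by simp
  with F show thesis by (rule that)
qed


section \<open>Bounded operators\<close>

definition csubspace :: "'a::complex_inner set \<Rightarrow> bool"
  where "csubspace S \<longleftrightarrow> 0 \<in> S \<and> (\<forall>x\<in>S. \<forall>y\<in>S. x + y \<in> S) \<and> (\<forall>a. \<forall>x\<in>S. a *\<^sub>C x \<in> S)"

text \<open>
  Bounded linear operators from \<open>A\<close> to \<open>B\<close>, where \<open>A\<close> and \<open>B\<close> are closed subspaces of the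
  ambient Hilbert spaces. The values of \<open>T\<close> outside \<open>A\<close> are irrelevant.
\<close>

definition bounded_op :: "'a::complex_inner set \<Rightarrow> 'b::complex_inner set \<Rightarrow> ('a \<Rightarrow> 'b) \<Rightarrow> bool"
  where "bounded_op A B T \<longleftrightarrow>
    (\<forall>x\<in>A. T x \<in> B) \<and>
    (\<forall>x\<in>A. \<forall>y\<in>A. T (x + y) = T x + T y) \<and>
    (\<forall>a. \<forall>x\<in>A. T (a *\<^sub>C x) = a *\<^sub>C T x) \<and>
    (\<exists>K. \<forall>x\<in>A. norm (T x) \<le> K * norm x)"

definition isometric_on :: "'a::complex_inner set \<Rightarrow> ('a \<Rightarrow> 'b::complex_inner) \<Rightarrow> bool"
  where "isometric_on A T \<longleftrightarrow> (\<forall>x\<in>A. norm (T x) = norm x)"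


section \<open>Fock space and odometer maps\<close>

text \<open>
  A word in the letters \<open>1, \<dots>, n\<close> is an element of \<open>lists {1..n}\<close>. \<open>fock n\<close> is the space of
  square-summable families on these words: at type \<open>(nat list, complex) ell2 set\<close> it is the full
  Fock space with orthonormal basis \<open>ket \<mu>\<close>, and at type \<open>(nat list, 'e) ell2 set\<close> it is its Hilbert
  space tensor product with \<open>'e\<close>.
\<close>

definition fock :: "nat \<Rightarrow> (nat list, 'e::complex_inner) ell2 set"
  where "fock n = {f. \<forall>\<mu>. \<mu> \<notin> lists {1..n} \<longrightarrow> coord f \<mu> = 0}"

abbreviation vacuum :: "(nat list, complex) ell2"  ("\<Omega>")
  where "\<Omega> \<equiv> ket []"

definition vacuum_space :: "(nat list, 'e::complex_inner) ell2 set"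
  where "vacuum_space = range (tensor \<Omega>)"

lemma csubspace_fock: "csubspace (fock n)"
  by (auto simp: csubspace_def fock_def)

lemma closed_fock: "closed (fock n)"
proof -
  have "fock n = (\<Inter>\<mu>\<in>- lists {1..n}. {f. coord f \<mu> = (0::'a)})"
    by (auto simp: fock_def)
  moreover have "closed {f. coord f \<mu> = (0::'a)}" for \<mu> :: "nat list"
  proof -
    have "bounded_linear (\<lambda>f. coord f \<mu> :: 'a)"
      by (rule bounded_linear_intro[where K = 1]) (auto simp: norm_coord_le)
    then show ?thesis
      by (intro closed_Collect_eq linear_continuous_on continuous_on_const)
  qed
  ultimately show ?thesis by auto
qed

lemma tensor_ket_in_fock: "\<mu> \<in> lists {1..n} \<Longrightarrow> tensor (ket \<mu>) \<eta> \<in> fock n"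
  by (auto simp: fock_def)

text \<open>Left tensoring by the basis vector \<open>ket \<nu>\<close> (see lemma \<open>left_tensor_tensor\<close>).\<close>

definition left_tensor :: "nat list \<Rightarrow> (nat list, 'e::complex_inner) ell2 \<Rightarrow> (nat list, 'e) ell2"
  where "left_tensor \<nu> f = Abs_ell2 (\<lambda>\<mu>. if take (length \<nu>) \<mu> = \<nu> then coord f (drop (length \<nu>) \<mu>) else 0)"

lemma has_sum_left_tensor:
  fixes h :: "nat list \<Rightarrow> real"
  assumes "(h has_sum s) UNIV"
  shows "((\<lambda>\<mu>. if take (length \<nu>) \<mu> = \<nu> then h (drop (length \<nu>) \<mu>) else 0) has_sum s) UNIV"
    (is "(?g has_sum s) UNIV")
proof -
  have "((?g \<circ> (@) \<nu>) has_sum s) UNIV"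
    using assms by (simp add: o_def)
  then have "(?g has_sum s) (range ((@) \<nu>))"
    by (subst has_sum_reindex) (auto simp: inj_on_def)
  moreover have "?g \<mu> = 0" if "\<mu> \<notin> range ((@) \<nu>)" for \<mu>
    using that by (metis append_take_drop_id rangeI)
  ultimately show ?thesis
    by (subst has_sum_cong_neutral[where T = "range ((@) \<nu>)" and g = ?g]) auto
qed

lemma left_tensor_square:
  "(\<lambda>\<mu>. (norm (if take (length \<nu>) \<mu> = \<nu> then h (drop (length \<nu>) \<mu>) else 0))\<^sup>2)
   = (\<lambda>\<mu>. if take (length \<nu>) \<mu> = \<nu> then (norm (h (drop (length \<nu>) \<mu>)))\<^sup>2 else 0)"
  by auto

lemma coord_left_tensor [simp]:
  "coord (left_tensor \<nu> f) \<mu> = (if take (length \<nu>) \<mu> = \<nu> then coord f (drop (length \<nu>) \<mu>) else 0)"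
proof -
  have "(\<lambda>\<mu>. (norm (if take (length \<nu>) \<mu> = \<nu> then coord f (drop (length \<nu>) \<mu>) else 0))\<^sup>2) summable_on UNIV"
    unfolding left_tensor_square
    using has_sum_left_tensor[OF has_sum_infsum[OF coord_summable[of f]]] summable_on_def by blast
  then show ?thesis by (simp add: left_tensor_def coord_Abs)
qed

lemma norm_left_tensor: "norm (left_tensor \<nu> f) = norm f"
  using infsumI[OF has_sum_left_tensor[OF has_sum_infsum[OF coord_summable[of f]]]]
  by (simp add: norm_ell2_def left_tensor_square)

lemma left_tensor_tensor: "left_tensor \<nu> (tensor (ket \<mu>) \<eta>) = tensor (ket (\<nu> @ \<mu>)) \<eta>"
proof (rule ell2_eqI)
  fix \<rho>
  have "(take (length \<nu>) \<rho> = \<nu> \<and> drop (length \<nu>) \<rho> = \<mu>) = (\<rho> = \<nu> @ \<mu>)"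
    by (metis append_eq_conv_conj append_take_drop_id)
  then show "coord (left_tensor \<nu> (tensor (ket \<mu>) \<eta>)) \<rho> = coord (tensor (ket (\<nu> @ \<mu>)) \<eta>) \<rho>"
    by auto
qed

text \<open>
  Adding one with carry: the \<open>k\<close> leading letters \<open>n\<close> become \<open>1\<close> and the first letter different
  from \<open>n\<close>, at 0-based position \<open>k\<close>, is incremented. Only used for words in which such a letter
  exists.
\<close>

definition carry :: "nat \<Rightarrow> nat list \<Rightarrow> nat list"
  where "carry n \<mu> =
    (let k = length (takeWhile (\<lambda>a. a = n) \<mu>) in replicate k 1 @ (\<mu> ! k + 1) # drop (k + 1) \<mu>)"

text \<open>
  \<open>odometer_map n L W\<close> says that \<open>W\<close> is the odometer map with symbol \<open>L\<close> and that it is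
  bounded. By lemma \<open>odometer_map_unique\<close>, \<open>L\<close> determines \<open>W\<close> on \<open>fock n\<close>.
\<close>

definition odometer_map ::
  "nat \<Rightarrow> ('e::complex_inner \<Rightarrow> (nat list, 'e) ell2) \<Rightarrow>
   ((nat list, 'e) ell2 \<Rightarrow> (nat list, 'e) ell2) \<Rightarrow> bool"
  where "odometer_map n L W \<longleftrightarrow>
    bounded_op (fock n) (fock n) W \<and>
    (\<forall>\<eta>. W (tensor \<Omega> \<eta>) = L \<eta>) \<and>
    (\<forall>m\<ge>1. \<forall>\<eta>. W (tensor (ket (replicate m n)) \<eta>) = left_tensor (replicate m 1) (L \<eta>)) \<and>
    (\<forall>\<mu>\<in>lists {1..n}. (\<exists>a\<in>set \<mu>. a \<noteq> n) \<longrightarrow>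
       (\<forall>\<eta>. W (tensor (ket \<mu>) \<eta>) = tensor (ket (carry n \<mu>)) \<eta>))"

lemma bounded_op_sum:
  assumes "bounded_op A B T" "csubspace A" "finite F" "\<And>i. i \<in> F \<Longrightarrow> f i \<in> A"
  shows "(\<Sum>i\<in>F. f i) \<in> A \<and> T (\<Sum>i\<in>F. f i) = (\<Sum>i\<in>F. T (f i))"
  using assms(3,4)
proof (induction F rule: finite_induct)
  case empty
  have 0: "(0::'a) \<in> A" using assms(2) by (simp add: csubspace_def)
  then have "T (0 *\<^sub>C 0) = 0 *\<^sub>C T 0" using assms(1) unfolding bounded_op_def by blast
  with 0 show ?case by simp
next
  case (insert x F)
  then show ?case using assms(1,2) by (simp add: bounded_op_def csubspace_def)
qed

lemma bounded_op_eqI: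
  fixes W W' :: "(nat list, 'e::complex_inner) ell2 \<Rightarrow> 'b::complex_inner"
  assumes W: "bounded_op (fock n) B W" and W': "bounded_op (fock n) B W'"
    and eq: "\<And>\<mu> \<eta>. \<mu> \<in> lists {1..n} \<Longrightarrow> W (tensor (ket \<mu>) \<eta>) = W' (tensor (ket \<mu>) \<eta>)"
    and f: "f \<in> fock n"
  shows "W f = W' f"
proof -
  obtain K where K: "\<And>x. x \<in> fock n \<Longrightarrow> norm (W x) \<le> K * norm x"
    using W unfolding bounded_op_def by blast
  obtain K' where K': "\<And>x. x \<in> fock n \<Longrightarrow> norm (W' x) \<le> K' * norm x"
    using W' unfolding bounded_op_def by blast
  define C where "C = \<bar>K\<bar> + \<bar>K'\<bar> + 1"
  have "norm (W f - W' f) \<le> 0 + e" if "e > 0" for e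
  proof -
    have "C > 0" by (simp add: C_def)
    with \<open>e > 0\<close> have "e / C > 0" by simp
    then obtain F where F: "finite F"
      and Fe: "norm (f - (\<Sum>\<mu>\<in>F. tensor (ket \<mu>) (coord f \<mu>))) < e / C"
      using ell2_finite_approximation by blast
    define s where "s = (\<Sum>\<mu>\<in>F. tensor (ket \<mu>) (coord f \<mu>))"
    have in_fock: "tensor (ket \<mu>) (coord f \<mu>) \<in> fock n" for \<mu>
      using f by (auto simp: fock_def)
    have s: "s \<in> fock n" and Ws: "W s = (\<Sum>\<mu>\<in>F. W (tensor (ket \<mu>) (coord f \<mu>)))"
      using bounded_op_sum[OF W csubspace_fock F in_fock] by (simp_all add: s_def)
    have W's: "W' s = (\<Sum>\<mu>\<in>F. W' (tensor (ket \<mu>) (coord f \<mu>)))"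
      using bounded_op_sum[OF W' csubspace_fock F in_fock] by (simp add: s_def)
    have "W (tensor (ket \<mu>) (coord f \<mu>)) = W' (tensor (ket \<mu>) (coord f \<mu>))" for \<mu>
    proof (cases "\<mu> \<in> lists {1..n}")
      case False
      then have "tensor (ket \<mu>) (coord f \<mu>) = 0 *\<^sub>C f"
        using f by (intro ell2_eqI) (auto simp: fock_def)
      moreover have "W (0 *\<^sub>C f) = 0 *\<^sub>C W f" "W' (0 *\<^sub>C f) = 0 *\<^sub>C W' f"
        using W W' f unfolding bounded_op_def by blast+
      ultimately show ?thesis by simp
    qed (rule eq)
    then have sW: "W s = W' s" by (simp add: Ws W's)
    have r: "f - s \<in> fock n" using f s by (auto simp: fock_def)
    have "W (f - s + s) = W (f - s) + W s" "W' (f - s + s) = W' (f - s) + W' s"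
      using W W' r s unfolding bounded_op_def by blast+
    then have "norm (W f - W' f) = norm (W (f - s) - W' (f - s))"
      by (simp add: sW)
    also have "\<dots> \<le> K * norm (f - s) + K' * norm (f - s)"
      using norm_triangle_ineq4[of "W (f - s)" "W' (f - s)"] K[OF r] K'[OF r] by linarith
    also have "\<dots> = (K + K') * norm (f - s)" by (simp add: algebra_simps)
    also have "\<dots> \<le> C * norm (f - s)"
      by (intro mult_right_mono) (auto simp: C_def)
    also have "\<dots> \<le> e"
      using Fe \<open>C > 0\<close> by (simp add: s_def[symmetric] field_simps)
    finally show ?thesis by simp
  qed
  then have "norm (W f - W' f) \<le> 0" by (rule field_le_epsilon)
  then show ?thesis by simp
qed

lemma odometer_map_unique:
  assumes W: "odometer_map n L W" and W': "odometer_map n L W'" and f: "f \<in> fock n"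
  shows "W f = W' f"
proof (rule bounded_op_eqI[OF _ _ _ f])
  show "bounded_op (fock n) (fock n) W" "bounded_op (fock n) (fock n) W'"
    using W W' by (simp_all add: odometer_map_def)
  fix \<mu> \<eta> assume \<mu>: "\<mu> \<in> lists {1..n}"
  show "W (tensor (ket \<mu>) \<eta>) = W' (tensor (ket \<mu>) \<eta>)"
  proof (cases "\<exists>a\<in>set \<mu>. a \<noteq> n")
    case True
    then show ?thesis using W W' \<mu> by (simp add: odometer_map_def)
  next
    case False
    then have \<mu>_eq: "\<mu> = replicate (length \<mu>) n"
      by (metis replicate_length_same)
    show ?thesis
    proof (cases "\<mu> = []")
      case True
      then show ?thesis using W W' by (simp add: odometer_map_def)
    next
      case False
      then have "length \<mu> \<ge> 1" by (simp add: Suc_leI)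
      then have "W (tensor (ket (replicate (length \<mu>) n)) \<eta>) = W' (tensor (ket (replicate (length \<mu>) n)) \<eta>)"
        using W W' unfolding odometer_map_def by presburger
      then show ?thesis using \<mu>_eq by simp
    qed
  qed
qed

end

theory Submission
  imports Defs
begin

text \<open>
  If \<open>ran L\<^sub>1 \<subseteq> ran L\<^sub>2\<close>, Douglas' range inclusion theorem gives \<open>L\<^sub>1 = L\<^sub>2 C\<close> with \<open>C\<close> bounded
  on \<open>E\<close>. An odometer map uses its symbol only on the vectors \<open>e\<^sub>n\<^sup>m \<otimes> \<eta>\<close>, so the operator that
  applies \<open>C\<close> to the coordinates at the words \<open>n\<^sup>m\<close>, \<open>m \<ge> 0\<close>, and fixes all other coordinates
  is a suitable \<open>\<Gamma>\<close>. Conversely, evaluating \<open>W\<^sub>1 = W\<^sub>2 \<Gamma>\<close> on \<open>\<Omega> \<otimes> E\<close> gives the range inclusion.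
  Here \<open>C \<eta>\<close> is the solution \<open>\<xi>\<close> of \<open>L\<^sub>2 \<xi> = L\<^sub>1 \<eta>\<close> of minimal norm, and it is bounded by Baire's
  theorem since the sets of all \<open>\<eta>\<close> with \<open>norm (C \<eta>) \<le> k\<close> are closed.
\<close>

section \<open>Elements of minimal norm\<close>

text \<open>
  Near-minimal elements of the sets form a Cauchy sequence by the parallelogram law, because
  the infima of the squared norms increase to a finite limit. This replaces weak compactness.
\<close>

lemma nested_closed_convex_Inter_nonempty:
  fixes S :: "nat \<Rightarrow> 'a::{real_inner,complete_space} set"
  assumes closed: "\<And>m. closed (S m)" and convex: "\<And>m. convex (S m)" and dec: "decseq S"
    and bound: "\<And>m. \<exists>x\<in>S m. norm x \<le> k"
  shows "\<exists>x. \<forall>m. x \<in> S m"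
proof -
  define d where "d m = (INF x\<in>S m. (norm x)\<^sup>2)" for m
  have bdd: "bdd_below ((\<lambda>x. (norm x)\<^sup>2) ` S m)" for m
    by (rule bdd_belowI[of _ 0]) auto
  have nonempty: "S m \<noteq> {}" for m
    using bound[of m] by auto
  have d_le: "d m \<le> (norm x)\<^sup>2" if "x \<in> S m" for x m
    unfolding d_def by (rule cINF_lower[OF bdd that])
  have "incseq d"
    unfolding d_def by (intro monoI cINF_superset_mono bdd nonempty) (use dec in \<open>auto dest: decseqD\<close>)
  have "d m \<le> k\<^sup>2" for m
  proof -
    obtain x where "x \<in> S m" "norm x \<le> k" using bound by blast
    then show ?thesis using d_le[of x m] power_mono[of "norm x" k 2] by simp
  qed
  then obtain D where D: "d \<longlonglongrightarrow> D" and d_le_D: "\<And>m. d m \<le> D"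
    using incseq_convergent[OF \<open>incseq d\<close>] by blast
  have "\<exists>x\<in>S m. (norm x)\<^sup>2 < d m + inverse (real (Suc m))" for m
    using cINF_less_iff[OF nonempty bdd, of m "d m + inverse (real (Suc m))"]
    unfolding d_def by simp
  then obtain x where x: "\<And>m. x m \<in> S m"
    and x_lt: "\<And>m. (norm (x m))\<^sup>2 < d m + inverse (real (Suc m))"
    by metis
  define u where "u m = inverse (real (Suc m))" for m
  define e where "e m = 2 * (D - d m) + 4 * u m" for m
  have "e \<longlonglongrightarrow> 2 * (D - D) + 4 * 0"
    unfolding e_def u_def by (intro tendsto_intros D LIMSEQ_inverse_real_of_nat)
  then have e: "e \<longlonglongrightarrow> 0" by simp
  have close: "(norm (x l - x m))\<^sup>2 \<le> e m" if "m \<le> l" for l m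
  proof -
    have "x l \<in> S m" using decseqD[OF dec that] x by blast
    then have "(1/2) *\<^sub>R x l + (1/2) *\<^sub>R x m \<in> S m"
      using convex x by (intro convexD) auto
    then have "d m \<le> (norm ((1/2) *\<^sub>R (x l + x m)))\<^sup>2"
      using d_le by (simp add: scaleR_add_right)
    then have mid: "4 * d m \<le> (norm (x l + x m))\<^sup>2"
      by (simp add: power_divide)
    have "u l \<le> u m"
      unfolding u_def using that by (intro le_imp_inverse_le) auto
    have "(norm (x l - x m))\<^sup>2 + (norm (x l + x m))\<^sup>2 = 2 * (norm (x l))\<^sup>2 + 2 * (norm (x m))\<^sup>2"
      by (simp add: power2_norm_eq_inner inner_simps algebra_simps)
    then have "(norm (x l - x m))\<^sup>2 = 2 * (norm (x l))\<^sup>2 + 2 * (norm (x m))\<^sup>2 - (norm (x l + x m))\<^sup>2"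
      by simp
    also have "\<dots> \<le> 2 * (d l + u l) + 2 * (d m + u m) - 4 * d m"
      using mid x_lt[of l, folded u_def] x_lt[of m, folded u_def]
      by (intro diff_mono add_mono) simp_all
    also have "\<dots> = 2 * (d l - d m) + 2 * (u l + u m)"
      by (simp add: algebra_simps)
    also have "\<dots> \<le> 2 * (D - d m) + 2 * (u m + u m)"
      using \<open>u l \<le> u m\<close> d_le_D[of l] by (intro add_mono) simp_all
    finally show ?thesis
      by (simp add: e_def)
  qed
  have "Cauchy x"
  proof (rule metric_CauchyI)
    fix r :: real assume "0 < r"
    then have "\<forall>\<^sub>F m in sequentially. e m < (r / 2)\<^sup>2"
      by (intro order_tendstoD(2)[OF e]) simp
    then obtain M where M: "e M < (r / 2)\<^sup>2"
      using eventually_happens'[OF sequentially_bot] by blast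
    have near: "dist (x l) (x M) < r / 2" if "M \<le> l" for l
    proof (rule power_less_imp_less_base)
      show "(dist (x l) (x M))\<^sup>2 < (r / 2)\<^sup>2"
        using close[OF that] M unfolding dist_norm by (rule le_less_trans)
    qed (use \<open>0 < r\<close> in simp)
    have "dist (x l) (x m) < r" if "M \<le> l" "M \<le> m" for l m
      using near that by (meson dist_triangle_half_l dist_commute)
    then show "\<exists>M. \<forall>l\<ge>M. \<forall>m\<ge>M. dist (x l) (x m) < r" by blast
  qed
  then obtain y where y: "x \<longlonglongrightarrow> y"
    by (meson Cauchy_convergent convergent_def)
  have "y \<in> S m" for m
  proof (rule Lim_in_closed_set[OF closed _ trivial_limit_sequentially y])
    show "\<forall>\<^sub>F n in sequentially. x n \<in> S m"
      using eventually_ge_at_top[of m] by eventually_elim (use x decseqD[OF dec] in blast)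
  qed
  then show ?thesis by blast
qed

lemma closed_convex_has_minimal_norm:
  fixes S :: "'a::{real_inner,complete_space} set"
  assumes "closed S" "convex S" "S \<noteq> {}"
  obtains x where "x \<in> S" "\<And>y. y \<in> S \<Longrightarrow> norm x \<le> norm y"
proof -
  define d where "d = (INF x\<in>S. norm x)"
  have bdd: "bdd_below (norm ` S)"
    by (rule bdd_belowI[of _ 0]) auto
  have near: "\<exists>x\<in>S. norm x \<le> d + inverse (real (Suc m))" for m
    using cINF_less_iff[OF assms(3) bdd, of "d + inverse (real (Suc m))"]
    unfolding d_def by (auto intro: less_imp_le)
  have "\<exists>x. \<forall>m. x \<in> S \<inter> cball 0 (d + inverse (real (Suc m)))"
  proof (rule nested_closed_convex_Inter_nonempty)
    show "decseq (\<lambda>m. S \<inter> cball 0 (d + inverse (real (Suc m))))"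
      by (intro decseq_SucI Int_mono subset_cball) (auto intro!: le_imp_inverse_le)
    fix m
    have "inverse (real (Suc m)) \<le> 1" by (simp add: inverse_le_1_iff)
    then show "\<exists>x\<in>S \<inter> cball 0 (d + inverse (real (Suc m))). norm x \<le> d + 1"
      using near[of m] by fastforce
  qed (use assms in \<open>auto intro: convex_Int\<close>)
  then obtain x where x: "x \<in> S" and x_le: "\<And>m. norm x \<le> d + inverse (real (Suc m))"
    by auto
  have "norm x \<le> d"
    using LIMSEQ_le_const[OF tendsto_add[OF tendsto_const LIMSEQ_inverse_real_of_nat, of d], of "norm x"]
      x_le by auto
  then have "norm x \<le> norm y" if "y \<in> S" for y
    using cINF_lower[OF bdd that] unfolding d_def by simp
  with x show thesis by (rule that)
qed

lemma minimal_norm_imp_orthogonal: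
  fixes x :: "'a::real_inner"
  assumes "subspace N" "\<And>z. z \<in> N \<Longrightarrow> norm x \<le> norm (x + z)" "z \<in> N"
  shows "inner x z = 0"
proof (cases "z = 0")
  case False
  define t where "t = - inner x z / inner z z"
  have zz: "inner z z > 0" using False by simp
  have "t *\<^sub>R z \<in> N" using assms by (simp add: subspace_scale)
  then have "(norm x)\<^sup>2 \<le> (norm (x + t *\<^sub>R z))\<^sup>2"
    using assms(2) by (intro power_mono) auto
  also have "\<dots> = (norm x)\<^sup>2 + 2 * t * inner x z + t * (t * inner z z)"
    by (simp add: power2_norm_eq_inner inner_simps inner_commute algebra_simps)
  also have "t * inner z z = - inner x z"
    using zz by (simp add: t_def)
  finally have "(inner x z)\<^sup>2 / inner z z \<le> 0"
    by (simp add: t_def power2_eq_square)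
  then show ?thesis
    using zz by (simp add: divide_le_0_iff)
qed simp

lemma orthogonal_imp_minimal_norm:
  fixes x :: "'a::real_inner"
  assumes "inner x z = 0"
  shows "norm x \<le> norm (x + z)"
proof (rule power2_le_imp_le)
  show "(norm x)\<^sup>2 \<le> (norm (x + z))\<^sup>2"
    using assms by (simp add: power2_norm_eq_inner inner_simps inner_commute)
qed simp

section \<open>Factorization through an operator with larger range\<close>

lemma bounded_linear_if_closed_sublevels:
  fixes C :: "'a::{real_normed_vector,complete_space} \<Rightarrow> 'b::real_normed_vector"
  assumes lin: "linear C" and closed: "\<And>k::nat. closed {x. norm (C x) \<le> real k}"
  shows "bounded_linear C"
proof -
  interpret linear C by (rule lin)
  let ?A = "\<lambda>k::nat. {x. norm (C x) \<le> real k}"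
  have "(\<Union>k. ?A k) = UNIV"
    using real_arch_simple by auto
  moreover have "interior (\<Union>k. ?A k) = {}" if "\<And>k. interior (?A k) = {}"
    using Baire_category_alt[of euclidean "range ?A"] that closed
    by (auto simp: completely_metrizable_space_euclidean)
  ultimately obtain k where "interior (?A k) \<noteq> {}" by auto
  then obtain a r where "r > 0" and ball: "cball a r \<subseteq> ?A k"
    by (auto simp: mem_interior_cball)
  have unit: "norm (C x) \<le> 2 * real k" if "norm x \<le> r" for x
  proof -
    have "a + x \<in> cball a r" "a \<in> cball a r"
      using that \<open>r > 0\<close> by (auto simp: dist_norm)
    then have "norm (C (a + x)) \<le> k" "norm (C a) \<le> k" using ball by blast+
    moreover have "C x = C (a + x) - C a" by (simp add: add)
    ultimately show ?thesis
      using norm_triangle_ineq4[of "C (a + x)" "C a"] by simp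
  qed
  have "norm (C x) \<le> norm x * (2 * real k / r)" for x
  proof (cases "x = 0")
    case True
    then show ?thesis by (simp add: zero)
  next
    case False
    have "norm (C ((r / norm x) *\<^sub>R x)) \<le> 2 * real k"
      using False \<open>r > 0\<close> by (intro unit) simp
    then show ?thesis
      using False \<open>r > 0\<close> by (simp add: scale field_simps)
  qed
  then show ?thesis
    by (intro bounded_linear_intro[where K = "2 * real k / r"]) (auto simp: add scale)
qed

lemma bounded_linear_range_subset_factorization:
  fixes A :: "'b::{real_normed_vector,complete_space} \<Rightarrow> 'c::real_normed_vector"
    and B :: "'a::{real_inner,complete_space} \<Rightarrow> 'c"
  assumes A: "bounded_linear A" and B: "bounded_linear B" and range: "range A \<subseteq> range B"
  obtains C where "bounded_linear C" "\<And>y. B (C y) = A y"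
    "\<And>y z. B z = 0 \<Longrightarrow> inner (C y) z = 0"
proof -
  interpret A: bounded_linear A by (rule A)
  interpret B: bounded_linear B by (rule B)
  have kernel: "subspace {z. B z = 0}"
    by (auto simp: subspace_def B.zero B.add B.scale)
  have "\<exists>x. B x = A y \<and> (\<forall>z. B z = 0 \<longrightarrow> inner x z = 0)" for y
  proof -
    have "closed {x. B x = A y}"
      by (intro closed_Collect_eq B.continuous_on continuous_on_id continuous_on_const)
    moreover have "convex {x. B x = A y}"
      by (auto simp: convex_def B.add B.scale scaleR_left_distrib[symmetric])
    moreover have "{x. B x = A y} \<noteq> {}"
    proof -
      have "A y \<in> range B" using range by blast
      then obtain x where "A y = B x" by blast
      then have "x \<in> {x. B x = A y}" by simp
      then show ?thesis by blast
    qed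
    ultimately obtain x where "x \<in> {x. B x = A y}"
      and "\<And>w. w \<in> {x. B x = A y} \<Longrightarrow> norm x \<le> norm w"
      by (rule closed_convex_has_minimal_norm) (rule that)
    then have x: "B x = A y" and min: "\<And>w. B w = A y \<Longrightarrow> norm x \<le> norm w"
      by simp_all
    have "inner x z = 0" if "B z = 0" for z
    proof (rule minimal_norm_imp_orthogonal[OF kernel])
      show "norm x \<le> norm (x + w)" if "w \<in> {z. B z = 0}" for w
        using that by (intro min) (simp add: B.add x)
    qed (use that in simp)
    with x show ?thesis by blast
  qed
  then obtain C where BC: "\<And>y. B (C y) = A y" and orth: "\<And>y z. B z = 0 \<Longrightarrow> inner (C y) z = 0"
    by metis
  have C_eqI: "x = C y" if "B x = A y" "\<And>z. B z = 0 \<Longrightarrow> inner x z = 0" for x y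
  proof -
    have "B (x - C y) = 0" by (simp add: B.diff BC that)
    then have "inner (x - C y) (x - C y) = 0"
      using that(2) orth by (simp add: inner_diff_left)
    then show ?thesis by simp
  qed
  have "linear C"
    by (intro linearI C_eqI[symmetric])
      (simp_all add: A.add A.scale B.add B.scale BC orth inner_add_left)
  moreover have "closed {y. norm (C y) \<le> real k}" for k
    unfolding closed_sequential_limits
  proof (intro allI impI, elim conjE)
    fix f y assume f: "\<forall>j. f j \<in> {y. norm (C y) \<le> real k}" and y: "f \<longlonglongrightarrow> y"
    let ?S = "\<lambda>m. cball 0 (real k) \<inter> B -` cball (A y) (inverse (real (Suc m)))"
    have "\<exists>x. \<forall>m. x \<in> ?S m"
    proof (rule nested_closed_convex_Inter_nonempty)
      show "closed (?S m)" for m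
        by (intro closed_Int closed_vimage closed_cball B.continuous_on continuous_on_id)
      show "convex (?S m)" for m
        by (intro convex_Int convex_linear_vimage convex_cball B.linear)
      show "decseq ?S"
        by (intro decseq_SucI Int_mono vimage_mono subset_cball order.refl le_imp_inverse_le) auto
      fix m
      have "(\<lambda>j. A (f j)) \<longlonglongrightarrow> A y" by (rule A.tendsto[OF y])
      then have "\<exists>J. \<forall>j\<ge>J. dist (A (f j)) (A y) < inverse (real (Suc m))"
        by (rule metric_LIMSEQ_D) simp
      then obtain j where "dist (A (f j)) (A y) < inverse (real (Suc m))" by blast
      then have "dist (A y) (B (C (f j))) \<le> inverse (real (Suc m))"
        unfolding BC dist_commute[of "A y"] by (rule less_imp_le)
      moreover have "norm (C (f j)) \<le> real k" using f by simp
      ultimately show "\<exists>x\<in>?S m. norm x \<le> real k"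
        by (intro bexI[of _ "C (f j)"]) simp_all
    qed
    then obtain x where x: "norm x \<le> real k"
      and Bx: "\<And>m. dist (A y) (B x) \<le> inverse (real (Suc m))" by auto
    have "dist (A y) (B x) \<le> 0"
      by (rule LIMSEQ_le_const[OF LIMSEQ_inverse_real_of_nat]) (use Bx in blast)
    then have "B (x - C y) = 0" by (simp add: B.diff BC)
    from orthogonal_imp_minimal_norm[OF orth[OF this, of y]]
    show "y \<in> {y. norm (C y) \<le> real k}" using x by simp
  qed
  ultimately have "bounded_linear C" by (rule bounded_linear_if_closed_sublevels)
  then show thesis using BC orth by (rule that)
qed

lemma bounded_op_imp_bounded_linear:
  assumes "bounded_op UNIV X T"
  shows "bounded_linear T"
proof -
  obtain K where "\<And>x. norm (T x) \<le> K * norm x"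
    using assms unfolding bounded_op_def by blast
  moreover have "T (r *\<^sub>R x) = r *\<^sub>R T x" for r x
    using assms by (simp add: bounded_op_def scaleC_of_real[symmetric])
  ultimately show ?thesis
    using assms by (intro bounded_linear_intro[where K = K]) (auto simp: bounded_op_def mult.commute)
qed

lemma inner_scaleC_left: "inner (a *\<^sub>C x) z = inner x (cnj a *\<^sub>C (z::'a::complex_inner))"
  by (simp add: Re_cinner[symmetric] cinner_scaleC_left cinner_scaleC_right)

theorem bounded_op_range_subset_factorization:
  fixes A :: "'b::chilbert_space \<Rightarrow> 'c::complex_inner" and B :: "'a::chilbert_space \<Rightarrow> 'c"
  assumes A: "bounded_op UNIV X A" and B: "bounded_op UNIV Y B" and range: "range A \<subseteq> range B"
  obtains C where "bounded_op UNIV UNIV C" "\<And>y. B (C y) = A y"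
proof -
  have lin: "bounded_linear A" "bounded_linear B"
    using A B by (simp_all add: bounded_op_imp_bounded_linear)
  interpret B: bounded_linear B by (rule lin)
  have scale: "A (a *\<^sub>C x) = a *\<^sub>C A x" "B (a *\<^sub>C w) = a *\<^sub>C B w" for a x w
    using A B by (auto simp: bounded_op_def)
  obtain C where C: "bounded_linear C" and BC: "\<And>y. B (C y) = A y"
    and orth: "\<And>y z. B z = 0 \<Longrightarrow> inner (C y) z = 0"
    using bounded_linear_range_subset_factorization[OF lin range] by blast
  interpret C: bounded_linear C by (rule C)
  have "C (a *\<^sub>C y) = a *\<^sub>C C y" for a y
  proof -
    let ?z = "C (a *\<^sub>C y) - a *\<^sub>C C y"
    have z: "B ?z = 0" by (simp add: B.diff BC scale)
    then have "B (cnj a *\<^sub>C ?z) = 0" by (simp add: scale)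
    with z have "inner ?z ?z = 0"
      using orth by (simp add: inner_diff_left inner_scaleC_left)
    then show ?thesis by simp
  qed
  moreover have "\<exists>K. \<forall>y. norm (C y) \<le> K * norm y"
    using C.bounded by (auto simp: mult.commute)
  ultimately have "bounded_op UNIV UNIV C"
    by (auto simp: bounded_op_def C.add)
  then show thesis using BC by (rule that)
qed

section \<open>Diagonal operators\<close>

definition diagonal_op :: "('i \<Rightarrow> 'e \<Rightarrow> 'f) \<Rightarrow> ('i, 'e::complex_inner) ell2 \<Rightarrow> ('i, 'f::complex_inner) ell2"
  where "diagonal_op T f = Abs_ell2 (\<lambda>i. T i (coord f i))"

context
  fixes T :: "'i \<Rightarrow> 'e::complex_inner \<Rightarrow> 'f::complex_inner" and K :: real
  assumes T: "\<And>i. bounded_op UNIV UNIV (T i)" and bound: "\<And>i x. norm (T i x) \<le> K * norm x"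
begin

lemma square_diagonal_le: "(norm (T i x))\<^sup>2 \<le> K\<^sup>2 * (norm x)\<^sup>2"
  using power_mono[OF bound[of i x], of 2] by (simp add: power_mult_distrib)

lemma diagonal_summable: "(\<lambda>i. (norm (T i (coord f i)))\<^sup>2) summable_on UNIV"
  by (rule summable_on_comparison_test[OF summable_on_cmult_right[OF coord_summable[of f]]])
    (auto intro: square_diagonal_le)

lemma coord_diagonal_op: "coord (diagonal_op T f) i = T i (coord f i)"
  by (simp add: diagonal_op_def coord_Abs diagonal_summable)

lemma diagonal_op_tensor_ket: "diagonal_op T (tensor (ket i) \<eta>) = tensor (ket i) (T i \<eta>)"
proof -
  have "T j (0 *\<^sub>C 0) = 0 *\<^sub>C T j 0" for j
    using T unfolding bounded_op_def by blast
  then show ?thesis by (intro ell2_eqI) (simp add: coord_diagonal_op)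
qed

lemma norm_diagonal_op_le: "norm (diagonal_op T f) \<le> \<bar>K\<bar> * norm f"
proof (rule power2_le_imp_le)
  have "(norm (diagonal_op T f))\<^sup>2 \<le> (\<Sum>\<^sub>\<infinity>i. K\<^sup>2 * (norm (coord f i))\<^sup>2)"
    unfolding norm_ell2_square coord_diagonal_op
    by (intro infsum_mono diagonal_summable summable_on_cmult_right coord_summable square_diagonal_le)
  also have "\<dots> = (\<bar>K\<bar> * norm f)\<^sup>2"
    by (simp add: infsum_cmult_right' norm_ell2_square power_mult_distrib)
  finally show "(norm (diagonal_op T f))\<^sup>2 \<le> (\<bar>K\<bar> * norm f)\<^sup>2" .
qed simp

end

lemma bounded_op_diagonal_op_fock:
  assumes T: "\<And>i. bounded_op UNIV UNIV (T i)" and bound: "\<And>i x. norm (T i x) \<le> K * norm x"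
  shows "bounded_op (fock n) (fock n) (diagonal_op T)"
proof -
  note [simp] = coord_diagonal_op[OF T bound]
  have T_zero: "T i 0 = 0" for i
    using bound[of i 0] by simp
  have "T i (x + y) = T i x + T i y" "T i (a *\<^sub>C x) = a *\<^sub>C T i x" for i x y a
    using T by (auto simp: bounded_op_def)
  moreover have "\<exists>K. \<forall>x\<in>fock n. norm (diagonal_op T x) \<le> K * norm x"
    using norm_diagonal_op_le[where T = T, OF T bound] by blast
  ultimately show ?thesis
    unfolding bounded_op_def by (auto simp: fock_def T_zero intro!: ell2_eqI)
qed

section \<open>Odometer maps\<close>

lemma isometric_on_left_factor_iff:
  assumes "isometric_on B V" "\<And>f. f \<in> A \<Longrightarrow> \<Gamma> f \<in> B" "\<And>f. f \<in> A \<Longrightarrow> W f = V (\<Gamma> f)"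
  shows "isometric_on A W \<longleftrightarrow> isometric_on A \<Gamma>"
  using assms unfolding isometric_on_def by simp

lemma tensor_vacuum_in_vacuum_space: "tensor \<Omega> \<eta> \<in> vacuum_space"
  by (simp add: vacuum_space_def)

lemma odometer_range_subset_if_factorization:
  assumes W1: "odometer_map n L1 W1" and W2: "odometer_map n L2 W2"
    and vac: "\<Gamma> ` vacuum_space \<subseteq> vacuum_space" and fac: "\<And>f. f \<in> fock n \<Longrightarrow> W1 f = W2 (\<Gamma> f)"
  shows "range L1 \<subseteq> range L2"
proof
  fix y assume "y \<in> range L1"
  then obtain \<eta> where "y = L1 \<eta>" by blast
  then have y: "y = W2 (\<Gamma> (tensor \<Omega> \<eta>))"
    using W1 fac[of "tensor \<Omega> \<eta>"] by (simp add: odometer_map_def tensor_ket_in_fock)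
  obtain \<xi> where "\<Gamma> (tensor \<Omega> \<eta>) = tensor \<Omega> \<xi>"
    using vac tensor_vacuum_in_vacuum_space[of \<eta>] unfolding vacuum_space_def by blast
  then show "y \<in> range L2"
    using W2 y by (simp add: odometer_map_def)
qed

lemma odometer_map_replicate:
  assumes "odometer_map n L W"
  shows "W (tensor (ket (replicate m n)) \<eta>) = left_tensor (replicate m 1) (L \<eta>)"
proof (cases "m = 0")
  case True
  have "left_tensor [] f = f" for f :: "(nat list, 'a) ell2"
    by (rule ell2_eqI) simp
  with True show ?thesis using assms by (simp add: odometer_map_def)
next
  case False
  then show ?thesis using assms by (simp add: odometer_map_def)
qed

lemma odometer_factorization_if_range_subset:
  fixes L1 L2 :: "'e::chilbert_space \<Rightarrow> (nat list, 'e) ell2"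
  assumes L: "bounded_op UNIV (fock n) L1" "bounded_op UNIV (fock n) L2"
    and W1: "odometer_map n L1 W1" and W2: "odometer_map n L2 W2"
    and range: "range L1 \<subseteq> range L2"
  shows "\<exists>\<Gamma>. bounded_op (fock n) (fock n) \<Gamma> \<and> \<Gamma> ` vacuum_space \<subseteq> vacuum_space \<and>
           (\<forall>f\<in>fock n. W1 f = W2 (\<Gamma> f))"
proof -
  obtain C where C: "bounded_op UNIV UNIV C" and LC: "\<And>\<eta>. L2 (C \<eta>) = L1 \<eta>"
    using bounded_op_range_subset_factorization[OF L range] by blast
  obtain K where K: "\<And>\<eta>. norm (C \<eta>) \<le> K * norm \<eta>"
    using C unfolding bounded_op_def by blast
  define T where "T \<mu> = (if set \<mu> \<subseteq> {n} then C else (\<lambda>\<eta>. \<eta>))" for \<mu>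
  have T: "bounded_op UNIV UNIV (T \<mu>)" for \<mu>
    using C by (auto simp: T_def bounded_op_def intro!: exI[of _ 1])
  have bound: "norm (T \<mu> \<eta>) \<le> max K 1 * norm \<eta>" for \<mu> \<eta>
  proof -
    have "K * norm \<eta> \<le> max K 1 * norm \<eta>" "1 * norm \<eta> \<le> max K 1 * norm \<eta>"
      by (intro mult_right_mono; simp)+
    then show ?thesis using K[of \<eta>] by (auto simp: T_def)
  qed
  note ket = diagonal_op_tensor_ket[OF T bound]
  have bounded: "bounded_op (fock n) (fock n) (diagonal_op T)"
    by (rule bounded_op_diagonal_op_fock[OF T bound])
  have W: "bounded_op (fock n) (fock n) W1" "bounded_op (fock n) (fock n) W2"
    using W1 W2 by (simp_all add: odometer_map_def)
  have comp: "bounded_op (fock n) (fock n) (\<lambda>f. W2 (diagonal_op T f))"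
  proof -
    obtain K2 where K2: "\<And>f. f \<in> fock n \<Longrightarrow> norm (W2 f) \<le> K2 * norm f"
      using W(2) unfolding bounded_op_def by blast
    have in_fock: "diagonal_op T f \<in> fock n" if "f \<in> fock n" for f
      using bounded that by (simp add: bounded_op_def)
    have "norm (W2 (diagonal_op T f)) \<le> (\<bar>K2\<bar> * \<bar>max K 1\<bar>) * norm f" if "f \<in> fock n" for f
    proof -
      have "norm (W2 (diagonal_op T f)) \<le> K2 * norm (diagonal_op T f)"
        using K2 in_fock that by blast
      also have "\<dots> \<le> \<bar>K2\<bar> * (\<bar>max K 1\<bar> * norm f)"
        by (intro mult_mono norm_diagonal_op_le[OF T bound]) auto
      finally show ?thesis by (simp add: mult.assoc)
    qed
    then show ?thesis
      using bounded W(2) in_fock unfolding bounded_op_def by (intro conjI) auto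
  qed
  have "W1 f = W2 (diagonal_op T f)" if "f \<in> fock n" for f
  proof (rule bounded_op_eqI[OF W(1) comp _ that])
    fix \<mu> \<eta> assume \<mu>: "\<mu> \<in> lists {1..n}"
    show "W1 (tensor (ket \<mu>) \<eta>) = W2 (diagonal_op T (tensor (ket \<mu>) \<eta>))"
    proof (cases "set \<mu> \<subseteq> {n}")
      case True
      then have "\<mu> = replicate (length \<mu>) n"
        by (metis replicate_length_same singletonD subsetD)
      then obtain m where "\<mu> = replicate m n" by blast
      moreover from this True have "T \<mu> = C" by (simp only: T_def if_True)
      ultimately show ?thesis
        by (simp add: ket odometer_map_replicate[OF W1] odometer_map_replicate[OF W2] LC)
    next
      case False
      then have "\<exists>a\<in>set \<mu>. a \<noteq> n" by blast
      then show ?thesis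
        using W1 W2 \<mu> False by (simp add: odometer_map_def ket T_def)
    qed
  qed
  moreover have "diagonal_op T ` vacuum_space \<subseteq> vacuum_space"
    by (auto simp: vacuum_space_def ket)
  ultimately show ?thesis using bounded by blast
qed

theorem theorem4p1:
  fixes n :: nat
    and L1 L2 :: "'e::chilbert_space \<Rightarrow> (nat list, 'e) ell2"
    and W1 W2 :: "(nat list, 'e) ell2 \<Rightarrow> (nat list, 'e) ell2"
  assumes "n \<ge> 1"
    and "separable_space (euclidean :: 'e topology)"
    and "bounded_op UNIV (fock n) L1"
    and "bounded_op UNIV (fock n) L2"
    and "odometer_map n L1 W1"
    and "odometer_map n L2 W2"
  shows "(range L1 \<subseteq> range L2 \<longleftrightarrow>
           (\<exists>\<Gamma>. bounded_op (fock n) (fock n) \<Gamma> \<and>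
                \<Gamma> ` vacuum_space \<subseteq> vacuum_space \<and>
                (\<forall>f\<in>fock n. W1 f = W2 (\<Gamma> f)))) \<and>
         (isometric_on (fock n) W2 \<longrightarrow>
           (\<forall>\<Gamma>. bounded_op (fock n) (fock n) \<Gamma> \<and>
                \<Gamma> ` vacuum_space \<subseteq> vacuum_space \<and>
                (\<forall>f\<in>fock n. W1 f = W2 (\<Gamma> f)) \<longrightarrow>
                (isometric_on (fock n) W1 \<longleftrightarrow> isometric_on (fock n) \<Gamma>)))"
proof (intro conjI impI allI, rule iffI)
  assume "range L1 \<subseteq> range L2"
  then show "\<exists>\<Gamma>. bounded_op (fock n) (fock n) \<Gamma> \<and> \<Gamma> ` vacuum_space \<subseteq> vacuum_space \<and>
      (\<forall>f\<in>fock n. W1 f = W2 (\<Gamma> f))"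
    by (rule odometer_factorization_if_range_subset[OF assms(3-6)])
next
  assume "\<exists>\<Gamma>. bounded_op (fock n) (fock n) \<Gamma> \<and> \<Gamma> ` vacuum_space \<subseteq> vacuum_space \<and>
      (\<forall>f\<in>fock n. W1 f = W2 (\<Gamma> f))"
  then show "range L1 \<subseteq> range L2"
    using odometer_range_subset_if_factorization[OF assms(5,6)] by blast
next
  fix \<Gamma>
  assume W2: "isometric_on (fock n) W2"
    and \<Gamma>: "bounded_op (fock n) (fock n) \<Gamma> \<and> \<Gamma> ` vacuum_space \<subseteq> vacuum_space \<and>
      (\<forall>f\<in>fock n. W1 f = W2 (\<Gamma> f))"
  show "isometric_on (fock n) W1 \<longleftrightarrow> isometric_on (fock n) \<Gamma>"
  proof (rule isometric_on_left_factor_iff[OF W2])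
    show "\<Gamma> f \<in> fock n" if "f \<in> fock n" for f
      using \<Gamma> that unfolding bounded_op_def by blast
    show "W1 f = W2 (\<Gamma> f)" if "f \<in> fock n" for f
      using \<Gamma> that by blast
  qed
qed

end
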